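(* Let $B$ be a left brace with trivial socle. Let $\mathcal{O}$ be the set of orbits of the action $\lambda$ of $(B,\cdot)$ on $B$, and for each $i\in\mathcal{O}$ fix an element $a_i\in i$, with stabilizer $\operatorname{St}(a_i)=\{b\in B:\lambda_b(a_i)=a_i\}\leq(B,\cdot)$. Let $I$ be a non-empty subset of $\mathcal{O}$ such that $\bigcup_{i\in I}i$ generates $(B,+)$ and such that $$\bigcap_{i\in I}\operatorname{core}_{(B,\cdot)}(\operatorname{St}(a_i))$$ is trivial. Let $X=\bigsqcup_{i\in I}B/\operatorname{St}(a_i)$ be the disjoint union of the sets of left cosets of $\operatorname{St}(a_i)$ in $(B,\cdot)$, and let $r:X\times X\to X\times X$ be given by $r(x,y)=\left(f_x(y),\,f^{-1}_{f_x(y)}(x)\right)$, where $f_x(y)=\lambda_{b_1}(a_{i_1})\,b_2\operatorname{St}(a_{i_2})$ for $x=b_1\operatorname{St}(a_{i_1})$ and $y=b_2\operatorname{St}(a_{i_2})$. Then the involutive non-degenerate solution $(X,r)$ is irretractable. Moreover, any irretractable non-degenerate involutive solution can, up to isomorphism, be constructed in this way (from some left brace $B$ with trivial socle and some such $I$ and $a_i$).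
   Context: A left brace is a set $B$ with two operations $+,\cdot$ such that $(B,+)$ is an abelian group, $(B,\cdot)$ is a group and $a\cdot(b+c)+a=a\cdot b+a\cdot c$ for all $a,b,c\in B$; the two identity elements coincide. Put $\lambda_a(b)=-a+a\cdot b$; then $a\mapsto\lambda_a$ is a group morphism $(B,\cdot)\to\operatorname{Aut}(B,+)$. The socle of $B$ is $\operatorname{Soc}(B)=\{b\in B:\lambda_b=\operatorname{id}\}$. For a subgroup $H$ of a group $G$, $\operatorname{core}_G(H)=\bigcap_{g\in G}gHg^{-1}$. A solution (of the Yang-Baxter equation) is a pair $(X,r)$ with $X$ non-empty and $r:X\times X\to X\times X$ bijective with $r_1r_2r_1=r_2r_1r_2$ on $X^3$, where $r_1=r\times\operatorname{id}$, $r_2=\operatorname{id}\times r$. Write $r(x,y)=(f_x(y),g_y(x))$; it is non-degenerate if all $f_x,g_x$ are bijective, and involutive if $r\circ r=\operatorname{id}$. For a non-degenerate involutive solution $(X,r)$, define $x\sim y$ iff $f_x=f_y$; the retraction $\operatorname{Ret}(X,r)$ is the induced solution on $X/\sim$, and $(X,r)$ is irretractable if $\operatorname{Ret}(X,r)=(X,r)$, i.e. if $f_x=f_y$ implies $x=y$. Solutions $(X,r)$ and $(Y,s)$ are isomorphic if there is a bijection $F:X\to Y$ with $s(F(x_1),F(x_2))=(F\times F)(r(x_1,x_2))$ for all $x_1,x_2\in X$. (The pair $(X,r)$ constructed in the claim is known to be an involutive non-degenerate solution.) *)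

theory Defs
  imports "HOL-Algebra.Ring" "HOL-Algebra.Group_Action" "HOL-Algebra.Left_Coset" "HOL-Algebra.Generated_Groups"
begin

section \<open>Left braces\<close>

text \<open>
  The record type of rings is reused for its two operations only: \<open>\<oplus>, \<zero>\<close> is the additive
  structure and \<open>\<otimes>, \<one>\<close> the multiplicative one, and \<^emph>\<open>both\<close> are groups on the whole carrier.
\<close>

locale left_brace = abelian_group B + group B for B (structure) +
  assumes compat: "\<lbrakk> a \<in> carrier B; b \<in> carrier B; c \<in> carrier B \<rbrakk>
    \<Longrightarrow> a \<otimes> (b \<oplus> c) \<oplus> a = a \<otimes> b \<oplus> a \<otimes> c"

definition lam :: "('b, 'm) ring_scheme \<Rightarrow> 'b \<Rightarrow> 'b \<Rightarrow> 'b" where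
  "lam B a b = \<ominus>\<^bsub>B\<^esub> a \<oplus>\<^bsub>B\<^esub> (a \<otimes>\<^bsub>B\<^esub> b)"

definition socle :: "('b, 'm) ring_scheme \<Rightarrow> 'b set" where
  "socle B = {b \<in> carrier B. \<forall>c \<in> carrier B. lam B b c = c}"

definition core :: "('b, 'm) monoid_scheme \<Rightarrow> 'b set \<Rightarrow> 'b set" where
  "core G H = (\<Inter>g \<in> carrier G. (g <#\<^bsub>G\<^esub> H) #>\<^bsub>G\<^esub> (inv\<^bsub>G\<^esub> g))"

abbreviation lam_orbits :: "('b, 'm) ring_scheme \<Rightarrow> 'b set set" where
  "lam_orbits B \<equiv> orbits B (carrier B) (lam B)"

abbreviation St :: "('b, 'm) ring_scheme \<Rightarrow> 'b \<Rightarrow> 'b set" where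
  "St B x \<equiv> stabilizer B (lam B) x"


section \<open>Set-theoretic solutions of the Yang-Baxter equation\<close>

text \<open>
  A solution is given by a carrier set \<open>X\<close> and a map \<open>r\<close> on the ambient type of pairs; the values
  of \<open>r\<close> outside \<open>X \<times> X\<close> are irrelevant.
\<close>

definition ybe_r1 :: "('x \<times> 'x \<Rightarrow> 'x \<times> 'x) \<Rightarrow> 'x \<times> 'x \<times> 'x \<Rightarrow> 'x \<times> 'x \<times> 'x" where
  "ybe_r1 r = (\<lambda>(x, y, z). (fst (r (x, y)), snd (r (x, y)), z))"

definition ybe_r2 :: "('x \<times> 'x \<Rightarrow> 'x \<times> 'x) \<Rightarrow> 'x \<times> 'x \<times> 'x \<Rightarrow> 'x \<times> 'x \<times> 'x" where
  "ybe_r2 r = (\<lambda>(x, y, z). (x, r (y, z)))"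

definition solution :: "'x set \<Rightarrow> ('x \<times> 'x \<Rightarrow> 'x \<times> 'x) \<Rightarrow> bool" where
  "solution X r \<longleftrightarrow> X \<noteq> {} \<and> bij_betw r (X \<times> X) (X \<times> X) \<and>
     (\<forall>t \<in> X \<times> X \<times> X. ybe_r1 r (ybe_r2 r (ybe_r1 r t)) = ybe_r2 r (ybe_r1 r (ybe_r2 r t)))"

definition sol_f :: "('x \<times> 'x \<Rightarrow> 'x \<times> 'x) \<Rightarrow> 'x \<Rightarrow> 'x \<Rightarrow> 'x" where
  "sol_f r x y = fst (r (x, y))"

definition sol_g :: "('x \<times> 'x \<Rightarrow> 'x \<times> 'x) \<Rightarrow> 'x \<Rightarrow> 'x \<Rightarrow> 'x" where
  "sol_g r y x = snd (r (x, y))"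

definition non_degenerate :: "'x set \<Rightarrow> ('x \<times> 'x \<Rightarrow> 'x \<times> 'x) \<Rightarrow> bool" where
  "non_degenerate X r \<longleftrightarrow>
     (\<forall>x \<in> X. bij_betw (sol_f r x) X X \<and> bij_betw (sol_g r x) X X)"

definition involutive :: "'x set \<Rightarrow> ('x \<times> 'x \<Rightarrow> 'x \<times> 'x) \<Rightarrow> bool" where
  "involutive X r \<longleftrightarrow> (\<forall>p \<in> X \<times> X. r (r p) = p)"

definition ndi_solution :: "'x set \<Rightarrow> ('x \<times> 'x \<Rightarrow> 'x \<times> 'x) \<Rightarrow> bool" where
  "ndi_solution X r \<longleftrightarrow> solution X r \<and> non_degenerate X r \<and> involutive X r"

text \<open>
  The relation whose quotient carries the retraction. The maps \<open>f\<^sub>x\<close> are maps \<open>X \<Rightarrow> X\<close>, so they are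
  compared on \<open>X\<close> only.
\<close>

definition ret_rel :: "'x set \<Rightarrow> ('x \<times> 'x \<Rightarrow> 'x \<times> 'x) \<Rightarrow> ('x \<times> 'x) set" where
  "ret_rel X r = {(x, y) \<in> X \<times> X. \<forall>z \<in> X. sol_f r x z = sol_f r y z}"

definition irretractable :: "'x set \<Rightarrow> ('x \<times> 'x \<Rightarrow> 'x \<times> 'x) \<Rightarrow> bool" where
  "irretractable X r \<longleftrightarrow> (\<forall>x y. (x, y) \<in> ret_rel X r \<longrightarrow> x = y)"

definition sol_isomorphic ::
  "'x set \<Rightarrow> ('x \<times> 'x \<Rightarrow> 'x \<times> 'x) \<Rightarrow> 'y set \<Rightarrow> ('y \<times> 'y \<Rightarrow> 'y \<times> 'y) \<Rightarrow> bool" where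
  "sol_isomorphic X r Y s \<longleftrightarrow>
     (\<exists>F. bij_betw F X Y \<and>
       (\<forall>x1 \<in> X. \<forall>x2 \<in> X. s (F x1, F x2) = map_prod F F (r (x1, x2))))"


section \<open>The solution associated with a left brace\<close>

text \<open>
  The family of base points is a function \<open>a\<close> on the set of orbits, so an orbit serves as its own
  index. Existence of a brace realising a given solution on a set of elements of \<open>'x\<close> has to name the
  type of its elements; \<open>'x \<Rightarrow> 'x\<close> is used, the type of the permutations generated by the \<open>f\<^sub>x\<close>, on
  which the brace of the solution lives.
\<close>

definition brace_data ::
  "('b, 'm) ring_scheme \<Rightarrow> 'b set set \<Rightarrow> ('b set \<Rightarrow> 'b) \<Rightarrow> bool" where
  "brace_data B I a \<longleftrightarrow>
     left_brace B \<and> socle B = {\<zero>\<^bsub>B\<^esub>} \<and>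
     (\<forall>i \<in> lam_orbits B. a i \<in> i) \<and>
     I \<subseteq> lam_orbits B \<and> I \<noteq> {} \<and>
     generate (add_monoid B) (\<Union>I) = carrier B \<and>
     (\<Inter>i \<in> I. core B (St B (a i))) = {\<one>\<^bsub>B\<^esub>}"

definition brace_X ::
  "('b, 'm) ring_scheme \<Rightarrow> 'b set set \<Rightarrow> ('b set \<Rightarrow> 'b) \<Rightarrow> ('b set \<times> 'b set) set" where
  "brace_X B I a = (SIGMA i:I. lcosets\<^bsub>B\<^esub> (St B (a i)))"

definition coset_rep :: "('b, 'm) monoid_scheme \<Rightarrow> 'b set \<Rightarrow> 'b set \<Rightarrow> 'b" where
  "coset_rep G H C = (SOME b. b \<in> carrier G \<and> C = b <#\<^bsub>G\<^esub> H)"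

text \<open>
  The definition chooses representatives of the two cosets; lemma \<open>brace_f_coset\<close> below shows that
  the result is the same for all representatives.
\<close>

definition brace_f ::
  "('b, 'm) ring_scheme \<Rightarrow> ('b set \<Rightarrow> 'b) \<Rightarrow> 'b set \<times> 'b set \<Rightarrow> 'b set \<times> 'b set \<Rightarrow> 'b set \<times> 'b set"
where
  "brace_f B a = (\<lambda>(i1, C1) (i2, C2).
     (let b1 = coset_rep B (St B (a i1)) C1;
          b2 = coset_rep B (St B (a i2)) C2
      in (i2, (lam B b1 (a i1) \<otimes>\<^bsub>B\<^esub> b2) <#\<^bsub>B\<^esub> St B (a i2))))"

definition brace_r ::
  "('b, 'm) ring_scheme \<Rightarrow> 'b set set \<Rightarrow> ('b set \<Rightarrow> 'b) \<Rightarrow>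
   ('b set \<times> 'b set) \<times> ('b set \<times> 'b set) \<Rightarrow> ('b set \<times> 'b set) \<times> ('b set \<times> 'b set)" where
  "brace_r B I a = (\<lambda>(x, y).
     (brace_f B a x y, inv_into (brace_X B I a) (brace_f B a (brace_f B a x y)) x))"


section \<open>Basic facts and well-definedness\<close>

context left_brace
begin

lemma one_eq_zero: "\<one> = \<zero>"
  using compat[of \<one> \<zero> \<zero>] by simp

lemma lam_closed:
  "a \<in> carrier B \<Longrightarrow> b \<in> carrier B \<Longrightarrow> lam B a b \<in> carrier B"
  by (simp add: lam_def)

lemma lam_one: "b \<in> carrier B \<Longrightarrow> lam B \<one> b = b"
  by (simp add: lam_def) (simp add: one_eq_zero)

lemma mult_eq: "a \<in> carrier B \<Longrightarrow> b \<in> carrier B \<Longrightarrow> a \<otimes> b = a \<oplus> lam B a b"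
  by (simp add: lam_def r_neg2)

lemma lam_add:
  assumes "a \<in> carrier B" "b \<in> carrier B" "c \<in> carrier B"
  shows "lam B a (b \<oplus> c) = lam B a b \<oplus> lam B a c"
proof -
  have "a \<oplus> lam B a (b \<oplus> c) \<oplus> a = (a \<oplus> lam B a b) \<oplus> (a \<oplus> lam B a c)"
    using compat[OF assms] assms by (simp add: mult_eq)
  then have "(a \<oplus> a) \<oplus> lam B a (b \<oplus> c) = (a \<oplus> a) \<oplus> (lam B a b \<oplus> lam B a c)"
    using assms by (simp add: lam_closed a_ac)
  then show ?thesis
    using assms lam_closed by simp
qed

lemma lam_mult:
  assumes "a \<in> carrier B" "b \<in> carrier B" "c \<in> carrier B"
  shows "lam B (a \<otimes> b) c = lam B a (lam B b c)"
proof -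
  have "(a \<otimes> b) \<otimes> c = a \<otimes> (b \<otimes> c)"
    using assms by (simp add: m_assoc)
  then have "(a \<otimes> b) \<oplus> lam B (a \<otimes> b) c = a \<oplus> lam B a (b \<oplus> lam B b c)"
    using assms by (metis m_closed mult_eq)
  also have "\<dots> = (a \<otimes> b) \<oplus> lam B a (lam B b c)"
    using assms by (simp add: lam_add lam_closed mult_eq[of a b] a_assoc)
  finally show ?thesis
    using assms by (simp add: lam_closed)
qed

lemma lam_St_coset:
  assumes "x \<in> carrier B" "b \<in> carrier B" "b' \<in> carrier B" "b <# St B x = b' <# St B x"
  shows "lam B b x = lam B b' x"
proof -
  have "\<one> \<in> St B x"
    using assms by (simp add: stabilizer_def lam_one)
  then have "b \<in> b <# St B x"
    using assms by (force simp: l_coset_def)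
  then obtain h where "h \<in> St B x" "b = b' \<otimes> h"
    using assms(4) by (auto simp: l_coset_def)
  then show ?thesis
    using assms by (simp add: stabilizer_def lam_mult)
qed

lemma brace_f_coset:
  assumes "a i1 \<in> carrier B" "a i2 \<in> carrier B" "b1 \<in> carrier B" "b2 \<in> carrier B"
  shows "brace_f B a (i1, b1 <# St B (a i1)) (i2, b2 <# St B (a i2)) =
    (i2, (lam B b1 (a i1) \<otimes> b2) <# St B (a i2))"
proof -
  have rep: "coset_rep B H (b <# H) \<in> carrier B \<and> b <# H = coset_rep B H (b <# H) <# H"
    if "b \<in> carrier B" for b H
    unfolding coset_rep_def by (rule someI[of _ b]) (use that in simp)
  define c1 c2 where "c1 = coset_rep B (St B (a i1)) (b1 <# St B (a i1))"
    and "c2 = coset_rep B (St B (a i2)) (b2 <# St B (a i2))"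
  have c: "c1 \<in> carrier B" "b1 <# St B (a i1) = c1 <# St B (a i1)"
    "c2 \<in> carrier B" "b2 <# St B (a i2) = c2 <# St B (a i2)"
    using rep assms unfolding c1_def c2_def by blast+
  have l: "lam B c1 (a i1) = lam B b1 (a i1)"
    using lam_St_coset assms c by metis
  have s: "St B (a i2) \<subseteq> carrier B"
    by (auto simp: stabilizer_def)
  have "(lam B b1 (a i1) \<otimes> c2) <# St B (a i2) = (lam B b1 (a i1) \<otimes> b2) <# St B (a i2)"
    using assms c s lam_closed by (simp flip: lcos_m_assoc)
  then show ?thesis
    by (simp add: brace_f_def Let_def l flip: c1_def c2_def)
qed

end

end

theory Submission
  imports Defs "HOL-Combinatorics.Permutations"
begin

text \<open>
  Every left brace carries the braiding \<open>r(a, b) = (\<lambda>\<^sub>a(b), (\<lambda>\<^sub>c)\<^sup>-\<^sup>1(a))\<close> with \<open>c = \<lambda>\<^sub>a(b)\<close>, and it restricts to every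
  union \<open>S\<close> of \<open>\<lambda>\<close>-orbits. The two products \<open>a b\<close> and \<open>c (\<lambda>\<^sub>c)\<^sup>-\<^sup>1(a)\<close> are both \<open>a + c\<close>, which yields the first component
  of the Yang-Baxter equation, and for an involutive map this component is sufficient (\<open>ndi_solutionI\<close>,
  \<open>orbit_r_ndi_solution\<close>). By orbit-stabilizer, \<open>b St(a\<^sub>i) \<mapsto> \<lambda>\<^sub>b(a\<^sub>i)\<close> identifies the disjoint union of cosets with
  the union \<open>S\<close> of the orbits in \<open>I\<close>, and the solution of the theorem with the braiding on \<open>S\<close>
  (\<open>pt_bij\<close>, \<open>brace_r_pt\<close>). The intersection of the cores is the set of all \<open>b\<close> such that \<open>\<lambda>\<^sub>b\<close> is the
  identity on \<open>S\<close> (\<open>Inter_core\<close>). If it is trivial, then \<open>b\<close> is determined by the restriction of \<open>\<lambda>\<^sub>b\<close> to \<open>S\<close>, in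
  particular a point \<open>b\<close> of \<open>S\<close> is determined by its map \<open>f\<^sub>b\<close>; this is irretractability.

  For the converse, let \<open>(X, r)\<close> be irretractable. The brace is the group \<open>G\<close> of permutations generated by the
  maps \<open>f\<^sub>x\<close>, and the point is to find its addition. If there is a brace structure in which \<open>\<lambda>\<^sub>p(f\<^sub>x) = f\<^bsub>p(x)\<^esub>\<close>,
  then adding \<open>f\<^sub>x\<close> is the map \<open>p \<mapsto> p f\<^sub>y\<close> with \<open>y = p\<^sup>-\<^sup>1(x)\<close>. These maps, called steps, can be defined on all
  permutations of \<open>X\<close>. They commute by the Yang-Baxter equation (\<open>step_commute\<close>), are invertible by non-degeneracy
  (\<open>diag_bij\<close>, \<open>step_unstep\<close>), and left multiplication by a permutation permutes them (\<open>step_equivariant\<close>).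
  So they generate an abelian group of translations. It is transitive on the orbit \<open>G\<close> of the identity, therefore
  regular in its action on \<open>G\<close>, and its group law becomes an addition on \<open>G\<close>. Equivariance makes \<open>G\<close> closed
  under composition and gives the brace identity (\<open>perm_brace_left_brace\<close>). An element \<open>p\<close> with \<open>\<lambda>\<^sub>p\<close> trivial on
  all \<open>f\<^sub>x\<close> satisfies \<open>f\<^bsub>p(x)\<^esub> = f\<^sub>x\<close>, so \<open>p(x) = x\<close> for all \<open>x\<close>; this is why the socle and the intersection of the
  cores are trivial (\<open>lam_fixes_perm\<close>). Finally, \<open>x \<mapsto> f\<^sub>x\<close> identifies \<open>(X, r)\<close> with the braiding on a
  union of orbits in \<open>G\<close>.
\<close>

section \<open>Involutive solutions from their first components\<close>

lemma r_eq: "r (x, y) = (sol_f r x y, sol_g r y x)"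
  by (simp add: sol_f_def sol_g_def)

text \<open>
  For an involutive solution \<open>sol_g\<close> is determined by \<open>sol_f\<close>, because \<open>f\<^bsub>f x y\<^esub>\<close> sends \<open>g\<^sub>y x\<close> back to \<open>x\<close>.
  Hence the Yang-Baxter equation follows from its first component alone: after that component is
  known, each of the two others is obtained by applying an injective map \<open>f\<close> to both sides.
\<close>

lemma ndi_solutionI:
  assumes ne: "X \<noteq> {}"
    and f: "\<And>x. x \<in> X \<Longrightarrow> bij_betw (sol_f r x) X X"
    and g: "\<And>y. y \<in> X \<Longrightarrow> bij_betw (sol_g r y) X X"
    and fg: "\<And>x y. \<lbrakk>x \<in> X; y \<in> X\<rbrakk> \<Longrightarrow> sol_f r (sol_f r x y) (sol_g r y x) = x"
    and ff: "\<And>x y z. \<lbrakk>x \<in> X; y \<in> X; z \<in> X\<rbrakk> \<Longrightarrow>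
      sol_f r x (sol_f r y z) = sol_f r (sol_f r x y) (sol_f r (sol_g r y x) z)"
  shows "ndi_solution X r"
proof -
  let ?f = "sol_f r" and ?g = "sol_g r"
  have fX: "?f x y \<in> X" and gX: "?g x y \<in> X" if "x \<in> X" "y \<in> X" for x y
    using f[OF that(1)] g[OF that(1)] that by (auto dest: bij_betwE)
  have f_cancel: "u = w" if "?f x u = ?f x w" "x \<in> X" "u \<in> X" "w \<in> X" for x u w
    using f[of x] that by (auto simp: bij_betw_def dest: inj_onD)
  have gf: "?g (?g y x) (?f x y) = y" if "x \<in> X" "y \<in> X" for x y
    using f_cancel[of x] fg[of "?f x y" "?g y x"] fg[of x y] fX gX that by metis
  have inv: "r (r p) = p" if "p \<in> X \<times> X" for p
    using that fg gf by (auto simp: r_eq)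
  have rX: "r p \<in> X \<times> X" if "p \<in> X \<times> X" for p
    using that fX gX by (auto simp: r_eq)
  have bij: "bij_betw r (X \<times> X) (X \<times> X)"
    by (rule bij_betw_byWitness[where f' = r]) (use inv rX in \<open>blast+\<close>)
  have ybe: "ybe_r1 r (ybe_r2 r (ybe_r1 r (x, y, z))) = ybe_r2 r (ybe_r1 r (ybe_r2 r (x, y, z)))"
    if X: "x \<in> X" "y \<in> X" "z \<in> X" for x y z
  proof -
    define p1 p2 p3 where "p1 = ?f (?f x y) (?f (?g y x) z)"
      and "p2 = ?g (?f (?g y x) z) (?f x y)" and "p3 = ?g z (?g y x)"
    define q1 q2 q3 where "q1 = ?f x (?f y z)"
      and "q2 = ?f (?g (?f y z) x) (?g z y)" and "q3 = ?g (?g z y) (?g (?f y z) x)"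
    have pX: "p1 \<in> X" "p2 \<in> X" "p3 \<in> X" "q2 \<in> X" "q3 \<in> X"
      unfolding p1_def p2_def p3_def q2_def q3_def using X by (simp_all add: fX gX)
    have 1: "p1 = q1"
      unfolding p1_def q1_def using ff X by simp
    \<comment> \<open>Both middle entries are sent to \<open>?f x y\<close> by \<open>?f p1\<close>.\<close>
    have "?f p1 p2 = ?f x y"
      unfolding p1_def p2_def using X by (simp add: fX gX fg)
    moreover have "?f q1 q2 = ?f x y"
      unfolding q1_def q2_def using ff[of x "?f y z" "?g z y"] X by (simp add: fX gX fg)
    ultimately have 2: "p2 = q2"
      using 1 f_cancel pX by metis
    \<comment> \<open>Both last entries are sent to \<open>x\<close> by \<open>?f p1 \<circ> ?f p2\<close>.\<close>
    have "?f p1 (?f p2 p3) = ?f (?f x y) (?f (?f (?g y x) z) p3)"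
      unfolding p1_def p2_def by (rule ff[symmetric]) (use X pX in \<open>simp_all add: fX gX\<close>)
    also have "\<dots> = x"
      unfolding p3_def using X by (simp add: fX gX fg)
    finally have "?f p1 (?f p2 p3) = x" .
    moreover have "?f q1 (?f q2 q3) = x"
      unfolding q1_def q2_def q3_def using X by (simp add: fX gX fg)
    ultimately have "p3 = q3"
      using 1 2 f_cancel fX pX by metis
    with 1 2 show ?thesis
      by (simp add: ybe_r1_def ybe_r2_def r_eq p1_def p2_def p3_def q1_def q2_def q3_def)
  qed
  show ?thesis
    unfolding ndi_solution_def solution_def non_degenerate_def involutive_def
    using ne bij ybe f g inv by auto
qed

locale ndi_sol =
  fixes X :: "'x set" and r
  assumes ndi: "ndi_solution X r"
begin

abbreviation "f \<equiv> sol_f r"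
abbreviation "g \<equiv> sol_g r"

lemma ne: "X \<noteq> {}"
  using ndi by (simp add: ndi_solution_def solution_def)

lemma f_bij: "x \<in> X \<Longrightarrow> bij_betw (f x) X X" and g_bij: "x \<in> X \<Longrightarrow> bij_betw (g x) X X"
  using ndi by (simp_all add: ndi_solution_def non_degenerate_def)

lemma f_closed: "x \<in> X \<Longrightarrow> y \<in> X \<Longrightarrow> f x y \<in> X"
  and g_closed: "x \<in> X \<Longrightarrow> y \<in> X \<Longrightarrow> g x y \<in> X"
  using f_bij[of x] g_bij[of x] by (auto dest: bij_betwE)

lemma f_cancel: "\<lbrakk>f x y = f x z; x \<in> X; y \<in> X; z \<in> X\<rbrakk> \<Longrightarrow> y = z"
  and g_cancel: "\<lbrakk>g x y = g x z; x \<in> X; y \<in> X; z \<in> X\<rbrakk> \<Longrightarrow> y = z"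
  using f_bij[of x] g_bij[of x] by (auto simp: bij_betw_def dest: inj_onD)

lemma involution:
  assumes "x \<in> X" "y \<in> X"
  shows "f (f x y) (g y x) = x" "g (g y x) (f x y) = y"
proof -
  have "r (r (x, y)) = (x, y)"
    using ndi assms by (simp add: ndi_solution_def involutive_def)
  then show "f (f x y) (g y x) = x" "g (g y x) (f x y) = y"
    by (simp_all add: r_eq)
qed

lemma f_f:
  assumes "x \<in> X" "y \<in> X" "z \<in> X"
  shows "f x (f y z) = f (f x y) (f (g y x) z)"
proof -
  have "ybe_r1 r (ybe_r2 r (ybe_r1 r (x, y, z))) = ybe_r2 r (ybe_r1 r (ybe_r2 r (x, y, z)))"
    using ndi assms by (simp add: ndi_solution_def solution_def)
  then show ?thesis
    by (simp add: ybe_r1_def ybe_r2_def r_eq)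
qed

end

text \<open>
  As \<open>g\<close> is determined by \<open>f\<close>, a bijection that respects the maps \<open>f\<close> is an isomorphism.
\<close>

lemma sol_isomorphicI:
  assumes X: "ndi_solution X r" and Y: "ndi_solution Y s" and F: "bij_betw F X Y"
    and hom: "\<And>x y. \<lbrakk>x \<in> X; y \<in> X\<rbrakk> \<Longrightarrow> F (sol_f r x y) = sol_f s (F x) (F y)"
  shows "sol_isomorphic X r Y s"
proof -
  interpret X: ndi_sol X r by standard (fact X)
  interpret Y: ndi_sol Y s by standard (fact Y)
  have FY: "F x \<in> Y" if "x \<in> X" for x using F that by (auto dest: bij_betwE)
  have "F (X.g y x) = Y.g (F y) (F x)" if "x \<in> X" "y \<in> X" for x y
  proof (rule Y.f_cancel)
    have "Y.f (F (X.f x y)) (F (X.g y x)) = F x"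
      using that by (simp add: hom[symmetric] X.f_closed X.g_closed X.involution)
    then show "Y.f (Y.f (F x) (F y)) (F (X.g y x)) = Y.f (Y.f (F x) (F y)) (Y.g (F y) (F x))"
      using that by (simp add: hom FY Y.involution)
  qed (use that in \<open>simp_all add: FY X.g_closed Y.f_closed Y.g_closed\<close>)
  then show ?thesis
    unfolding sol_isomorphic_def using F hom by (auto simp: r_eq intro!: exI[of _ F])
qed

lemma bij_betw_conjugate:
  assumes v: "bij_betw v X S" and h': "bij_betw h' S S"
    and h: "\<And>x. x \<in> X \<Longrightarrow> h x \<in> X" "\<And>x. x \<in> X \<Longrightarrow> v (h x) = h' (v x)"
  shows "bij_betw h X X"
proof -
  have "bij_betw (v \<circ> h) X S = bij_betw (h' \<circ> v) X S"
    by (rule bij_betw_cong) (use h in simp)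
  then have "bij_betw (v \<circ> h) X S"
    using bij_betw_trans[OF v h'] by simp
  then show ?thesis
    using bij_betw_comp_iff2[OF v, of h X] h(1) by blast
qed

lemma ndi_solution_transport:
  assumes S: "ndi_solution S s" and v: "bij_betw v X S"
    and r: "\<And>x y. \<lbrakk>x \<in> X; y \<in> X\<rbrakk> \<Longrightarrow> r (x, y) \<in> X \<times> X \<and> map_prod v v (r (x, y)) = s (v x, v y)"
  shows "ndi_solution X r"
proof -
  interpret S: ndi_sol S s by standard (fact S)
  have vS: "v x \<in> S" if "x \<in> X" for x using v that by (auto dest: bij_betwE)
  have inj: "x = y" if "v x = v y" "x \<in> X" "y \<in> X" for x y
    using v that by (auto simp: bij_betw_def dest: inj_onD)
  have cl: "sol_f r x y \<in> X" "sol_g r y x \<in> X"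
    and hom: "v (sol_f r x y) = S.f (v x) (v y)" "v (sol_g r y x) = S.g (v y) (v x)"
    if "x \<in> X" "y \<in> X" for x y
    using r[OF that] by (auto simp: r_eq)
  have bij: "bij_betw h X X" if "bij_betw h' S S" "\<And>y. y \<in> X \<Longrightarrow> h y \<in> X \<and> v (h y) = h' (v y)"
    for h h'
    using bij_betw_conjugate[OF v that(1)] that(2) by blast
  show ?thesis
  proof (rule ndi_solutionI)
    show "X \<noteq> {}" using S.ne v by (auto simp: bij_betw_def)
    show "bij_betw (sol_f r x) X X" if "x \<in> X" for x
      by (rule bij[OF S.f_bij[OF vS[OF that]]]) (use that in \<open>simp add: cl hom\<close>)
    show "bij_betw (sol_g r x) X X" if "x \<in> X" for x
      by (rule bij[OF S.g_bij[OF vS[OF that]]]) (use that in \<open>simp add: cl hom\<close>)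
    show "sol_f r (sol_f r x y) (sol_g r y x) = x" if "x \<in> X" "y \<in> X" for x y
      by (rule inj) (use that in \<open>simp_all add: cl hom vS S.involution\<close>)
    show "sol_f r x (sol_f r y z) = sol_f r (sol_f r x y) (sol_f r (sol_g r y x) z)"
      if "x \<in> X" "y \<in> X" "z \<in> X" for x y z
      by (rule inj) (use that in \<open>simp_all add: cl hom vS flip: S.f_f\<close>)
  qed
qed

section \<open>The solution on a union of orbits of a left brace\<close>

context left_brace
begin

lemma lam_inv_cancel:
  assumes "a \<in> carrier B" "b \<in> carrier B"
  shows "lam B (inv a) (lam B a b) = b" "lam B a (lam B (inv a) b) = b"
  using assms lam_mult[of "inv a" a b] lam_mult[of a "inv a" b] by (simp_all add: lam_one)

text \<open>
  With \<open>c = \<lambda>\<^sub>a(b)\<close> and \<open>d = (\<lambda>\<^sub>c)\<^sup>-\<^sup>1(a)\<close>, both products \<open>a b = a + \<lambda>\<^sub>a(b)\<close> and \<open>c d = c + \<lambda>\<^sub>c(d)\<close> equal \<open>a + c\<close>. Commutativity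
  of the addition is thus what makes \<open>(a, b) \<mapsto> (c, d)\<close> preserve products, and this is the first component
  of the Yang-Baxter equation.
\<close>

lemma mult_eq_lam_mult:
  assumes "a \<in> carrier B" "b \<in> carrier B"
  shows "lam B a b \<otimes> lam B (inv (lam B a b)) a = a \<otimes> b"
  using assms by (simp add: mult_eq lam_closed lam_inv_cancel a_comm)

text \<open>
  This inverts the second component \<open>a \<mapsto> d\<close> of the braiding for a fixed \<open>b\<close>. Write \<open>a'\<close>, \<open>d'\<close> for the
  multiplicative inverses and put \<open>c = \<lambda>\<^sub>a(b)\<close>. From \<open>a b = c d\<close> follows \<open>a' c = b d'\<close>; the left side is
  \<open>a' + b\<close> and the right side is \<open>b + \<lambda>\<^sub>b(d')\<close>, so \<open>a' = \<lambda>\<^sub>b(d')\<close>. Thus \<open>d\<close> and \<open>b\<close> determine \<open>a\<close>.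
\<close>

lemma lam_swap_eq:
  assumes b: "b \<in> carrier B" and d: "d \<in> carrier B"
  defines "a \<equiv> inv (lam B b (inv d))"
  shows "lam B a b = a \<otimes> b \<otimes> inv d" and "lam B (a \<otimes> b \<otimes> inv d) d = a"
proof -
  define c where "c = a \<otimes> b \<otimes> inv d"
  have cl: "a \<in> carrier B" "c \<in> carrier B"
    using b d by (simp_all add: a_def c_def lam_closed)
  have "inv a \<otimes> c = b \<otimes> inv d"
    using cl b d by (simp add: c_def m_assoc flip: m_assoc[of "inv a" a])
  also have "\<dots> = b \<oplus> inv a"
    using b d by (simp add: mult_eq a_def lam_closed)
  finally have "lam B (inv a) c = b"
    using cl b d by (simp add: lam_def a_comm[of b] r_neg1)
  then have c: "lam B a b = c"
    using lam_inv_cancel(2)[of a c] cl by simp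
  have "c \<oplus> lam B c d = a \<oplus> lam B a b"
    using cl b d by (simp add: c_def m_assoc flip: mult_eq)
  then have "c \<oplus> lam B c d = c \<oplus> a"
    using c cl by (simp add: a_comm)
  then have "lam B c d = a"
    using cl d lam_closed by simp
  with c show "lam B a b = a \<otimes> b \<otimes> inv d" "lam B (a \<otimes> b \<otimes> inv d) d = a"
    by (simp_all add: c_def)
qed

text \<open>
  The braiding of the brace itself. The solution on cosets is a copy of its restriction to a union of
  orbits; here the points are elements of \<open>B\<close>, and no representatives have to be chosen.
\<close>

definition orbit_r :: "'a \<times> 'a \<Rightarrow> 'a \<times> 'a" where
  "orbit_r = (\<lambda>(a, b). (lam B a b, lam B (inv (lam B a b)) a))"

lemma orbit_r_ndi_solution:
  assumes S: "S \<noteq> {}" "S \<subseteq> carrier B"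
    and inv: "\<And>b x. \<lbrakk>b \<in> carrier B; x \<in> S\<rbrakk> \<Longrightarrow> lam B b x \<in> S"
  shows "ndi_solution S orbit_r"
proof (rule ndi_solutionI)
  have f: "sol_f orbit_r a b = lam B a b" and g: "sol_g orbit_r b a = lam B (inv (lam B a b)) a" for a b
    by (simp_all add: sol_f_def sol_g_def orbit_r_def)
  note [simp] = f g lam_closed lam_inv_cancel
  have SB: "x \<in> carrier B" if "x \<in> S" for x using that S by auto
  show "bij_betw (sol_f orbit_r a) S S" if "a \<in> S" for a
    by (rule bij_betw_byWitness[where f' = "lam B (inv a)"])
      (use that SB inv in auto)
  show "S \<noteq> {}" by fact
  show "bij_betw (sol_g orbit_r b) S S" if bS: "b \<in> S" for b
  proof -
    \<comment> \<open>The candidate inverse, from the formula for \<open>a\<close> in terms of \<open>b\<close> and \<open>d\<close>; it returns \<open>?a d\<close> itself,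
      written as \<open>\<lambda>\<^sub>c(d)\<close> to make membership in \<open>S\<close> evident.\<close>
    let ?a = "\<lambda>d. inv (lam B b (inv d))"
    let ?h = "\<lambda>d. lam B (?a d \<otimes> b \<otimes> inv d) d"
    have h: "?h d \<in> S" "sol_g orbit_r b (?h d) = d" if "d \<in> S" for d
    proof -
      have cl: "b \<in> carrier B" "d \<in> carrier B"
        using bS that SB by auto
      then have c: "?a d \<otimes> b \<otimes> inv d \<in> carrier B"
        by (simp add: lam_closed)
      then show "?h d \<in> S"
        using inv that by blast
      show "sol_g orbit_r b (?h d) = d"
        using lam_swap_eq[OF cl] lam_inv_cancel(1)[OF c cl(2)] unfolding g by metis
    qed
    have gh: "?h (sol_g orbit_r b a) = a" if aS: "a \<in> S" for a
    proof -
      define c d where "c = lam B a b" and "d = lam B (inv c) a"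
      have cl: "a \<in> carrier B" "b \<in> carrier B" "c \<in> carrier B" "d \<in> carrier B"
        using aS bS SB by (simp_all add: c_def d_def)
      have "c \<otimes> d = a \<otimes> b"
        using mult_eq_lam_mult cl by (simp add: c_def d_def)
      then have "inv a \<otimes> c = b \<otimes> inv d"
        using cl by (metis inv_closed inv_solve_left inv_solve_right m_assoc m_closed)
      then have "inv a \<oplus> lam B (inv a) c = b \<oplus> lam B b (inv d)"
        using cl by (simp flip: mult_eq)
      then have "b \<oplus> inv a = b \<oplus> lam B b (inv d)"
        using cl by (simp add: c_def a_comm)
      then have "inv a = lam B b (inv d)"
        using cl by simp
      then have "?a d = a"
        using cl by (metis inv_inv)
      then show ?thesis
        using lam_swap_eq[of b d] cl by (simp add: c_def d_def)
    qed
    show ?thesis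
    proof (rule bij_betw_byWitness[where f' = ?h])
      show "\<forall>a\<in>S. ?h (sol_g orbit_r b a) = a" "\<forall>d\<in>S. sol_g orbit_r b (?h d) = d" "?h ` S \<subseteq> S"
        using h gh by blast+
      show "sol_g orbit_r b ` S \<subseteq> S"
        using inv SB bS by auto
    qed
  qed
  show "sol_f orbit_r (sol_f orbit_r a b) (sol_g orbit_r b a) = a" if "a \<in> S" "b \<in> S" for a b
    using that SB by simp
  show "sol_f orbit_r a (sol_f orbit_r b c) = sol_f orbit_r (sol_f orbit_r a b) (sol_f orbit_r (sol_g orbit_r b a) c)"
    if "a \<in> S" "b \<in> S" "c \<in> S" for a b c
    using that SB mult_eq_lam_mult[of a b] by (simp flip: lam_mult)
qed

end


section \<open>Cosets of stabilizers as points of orbits\<close>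

text \<open>
  The conjugates of a stabilizer are the stabilizers of the other points of the orbit. This turns the
  core into a pointwise stabilizer.
\<close>

lemma (in left_brace) St_lam:
  assumes g: "g \<in> carrier B" and x: "x \<in> carrier B"
  shows "(g <# St B x) #> inv g = St B (lam B g x)"
proof (intro equalityI subsetI)
  fix b assume "b \<in> (g <# St B x) #> inv g"
  then obtain h where h: "h \<in> carrier B" "lam B h x = x" "b = g \<otimes> h \<otimes> inv g"
    by (auto simp: l_coset_def r_coset_def stabilizer_def)
  then show "b \<in> St B (lam B g x)"
    using g x by (simp add: stabilizer_def lam_mult lam_closed lam_inv_cancel)
next
  fix b assume "b \<in> St B (lam B g x)"
  then have b: "b \<in> carrier B" "lam B b (lam B g x) = lam B g x"
    by (simp_all add: stabilizer_def)
  then have "inv g \<otimes> b \<otimes> g \<in> St B x"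
    using g x by (simp add: stabilizer_def lam_mult lam_closed lam_inv_cancel)
  moreover have "b = g \<otimes> (inv g \<otimes> b \<otimes> g) \<otimes> inv g"
    using g b(1) by (simp add: m_assoc flip: m_assoc[of g "inv g"])
  ultimately show "b \<in> (g <# St B x) #> inv g"
    unfolding l_coset_def r_coset_def by blast
qed

locale brace_orbits = left_brace B for B (structure) +
  fixes I :: "'a set set" and a :: "'a set \<Rightarrow> 'a"
  assumes I: "I \<noteq> {}" "I \<subseteq> lam_orbits B" and a_mem: "i \<in> I \<Longrightarrow> a i \<in> i"
begin

abbreviation "X \<equiv> brace_X B I a"

text \<open>
  The orbit-stabilizer bijection: a coset \<open>b St(a\<^sub>i)\<close> is the point \<open>\<lambda>\<^sub>b(a\<^sub>i)\<close> of the orbit \<open>i\<close>.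
\<close>

definition pt :: "'a set \<times> 'a set \<Rightarrow> 'a" where
  "pt = (\<lambda>(i, C). lam B (coset_rep B (St B (a i)) C) (a i))"

lemma orbit_eq:
  assumes "i \<in> I"
  shows "(\<lambda>b. lam B b (a i)) ` carrier B = i"
proof -
  obtain x where x: "x \<in> carrier B" "i = {lam B b x | b. b \<in> carrier B}"
    using subsetD[OF I(2) assms] by (auto simp: orbits_def orbit_def)
  then obtain c where c: "c \<in> carrier B" "a i = lam B c x"
    using a_mem[OF assms] by auto
  have 1: "lam B b (a i) = lam B (b \<otimes> c) x" if "b \<in> carrier B" for b
    using that c x by (simp add: lam_mult)
  have 2: "lam B b x = lam B (b \<otimes> inv c) (a i)" if "b \<in> carrier B" for b
    using that c x by (simp add: lam_mult lam_inv_cancel lam_closed)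
  show ?thesis
  proof (intro equalityI subsetI)
    fix s assume "s \<in> (\<lambda>b. lam B b (a i)) ` carrier B"
    then obtain b where "b \<in> carrier B" "s = lam B (b \<otimes> c) x"
      using 1 by blast
    then show "s \<in> i"
      by (subst x(2)) (use c(1) in auto)
  next
    fix s assume "s \<in> i"
    then obtain b where "b \<in> carrier B" "s = lam B b x"
      by (subst (asm) x(2)) blast
    then show "s \<in> (\<lambda>b. lam B b (a i)) ` carrier B"
      using 2[of b] c(1) by blast
  qed
qed

lemma lam_mem_orbit: "i \<in> I \<Longrightarrow> b \<in> carrier B \<Longrightarrow> lam B b (a i) \<in> i"
  using orbit_eq by blast

lemma Union_cases:
  assumes "s \<in> \<Union>I"
  obtains i b where "i \<in> I" "b \<in> carrier B" "s = lam B b (a i)"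
proof -
  obtain i where i: "i \<in> I" "s \<in> i"
    using assms by blast
  then have "s \<in> (\<lambda>b. lam B b (a i)) ` carrier B"
    using orbit_eq[OF i(1)] by simp
  with i that show ?thesis
    by blast
qed

lemma orbit_carrier: "i \<in> I \<Longrightarrow> i \<subseteq> carrier B"
  using I by (auto simp: orbits_def orbit_def lam_closed)

lemma a_closed: "i \<in> I \<Longrightarrow> a i \<in> carrier B"
  using orbit_carrier a_mem by blast

lemma orbit_eqI:
  assumes "i \<in> I" "j \<in> I" "lam B b (a i) = lam B c (a j)" "b \<in> carrier B" "c \<in> carrier B"
  shows "i = j"
proof -
  have *: "lam B d (a i) \<in> j" if "a i = lam B e (a j)" "i \<in> I" "j \<in> I" "d \<in> carrier B" "e \<in> carrier B" for d e i j
    using that lam_mem_orbit[of j "d \<otimes> e"] by (simp add: lam_mult a_closed)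
  have "a i = lam B (inv b \<otimes> c) (a j)"
    using assms lam_inv_cancel(1)[of b "a i"] by (simp add: lam_mult a_closed)
  then have 1: "i \<subseteq> j"
    using *[of i "inv b \<otimes> c" j] assms by (subst orbit_eq[symmetric, of i]) auto
  have "a j = lam B (inv c \<otimes> b) (a i)"
    using assms lam_inv_cancel(1)[of c "a j"] by (simp add: lam_mult a_closed)
  then have "j \<subseteq> i"
    using *[of j "inv c \<otimes> b" i] assms by (subst orbit_eq[symmetric, of j]) auto
  with 1 show ?thesis by blast
qed

lemma lam_Union:
  assumes "b \<in> carrier B" "x \<in> \<Union>I"
  shows "lam B b x \<in> \<Union>I"
proof -
  obtain i c where ic: "i \<in> I" "c \<in> carrier B" "x = lam B c (a i)"
    using assms(2) by (rule Union_cases)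
  then have "lam B b x = lam B (b \<otimes> c) (a i)"
    using assms a_closed by (simp add: lam_mult)
  then show ?thesis
    using ic assms lam_mem_orbit[of i "b \<otimes> c"] by (auto intro: UnionI)
qed

lemma X_cases:
  assumes "x \<in> X"
  obtains i b where "i \<in> I" "b \<in> carrier B" "x = (i, b <# St B (a i))"
  using assms by (auto simp: brace_X_def LCOSETS_def)

lemma coset_mem_X: "i \<in> I \<Longrightarrow> b \<in> carrier B \<Longrightarrow> (i, b <# St B (a i)) \<in> X"
  by (auto simp: brace_X_def LCOSETS_def)

lemma pt_coset:
  assumes "i \<in> I" "b \<in> carrier B"
  shows "pt (i, b <# St B (a i)) = lam B b (a i)"
proof -
  define c where "c = coset_rep B (St B (a i)) (b <# St B (a i))"
  have c: "c \<in> carrier B \<and> b <# St B (a i) = c <# St B (a i)"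
    unfolding c_def coset_rep_def by (rule someI[of _ b]) (use assms in simp)
  have "lam B c (a i) = lam B b (a i)"
    by (rule lam_St_coset) (use c assms a_closed in simp_all)
  then show ?thesis
    by (simp add: pt_def flip: c_def)
qed

lemma coset_eqI:
  assumes "x \<in> carrier B" "b \<in> carrier B" "c \<in> carrier B" "lam B b x = lam B c x"
  shows "b <# St B x = c <# St B x"
proof -
  have *: "b <# St B x \<subseteq> c <# St B x"
    if "b \<in> carrier B" "c \<in> carrier B" "lam B b x = lam B c x" for b c
  proof
    fix y assume "y \<in> b <# St B x"
    then obtain h where h: "h \<in> carrier B" "lam B h x = x" "y = b \<otimes> h"
      by (auto simp: l_coset_def stabilizer_def)
    have "inv c \<otimes> b \<otimes> h \<in> St B x"
      using h that assms(1) by (simp add: stabilizer_def lam_mult lam_inv_cancel)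
    moreover have "y = c \<otimes> (inv c \<otimes> b \<otimes> h)"
      using h that by (simp flip: m_assoc)
    ultimately show "y \<in> c <# St B x"
      unfolding l_coset_def by blast
  qed
  show ?thesis
    using *[of b c] *[of c b] assms by auto
qed

lemma pt_bij: "bij_betw pt X (\<Union>I)"
proof (rule bij_betwI')
  fix x y assume "x \<in> X" "y \<in> X"
  then obtain i b j c where x: "i \<in> I" "b \<in> carrier B" "x = (i, b <# St B (a i))"
    and y: "j \<in> I" "c \<in> carrier B" "y = (j, c <# St B (a j))"
    by (meson X_cases)
  show "pt x = pt y \<longleftrightarrow> x = y"
  proof
    assume "pt x = pt y"
    then have eq: "lam B b (a i) = lam B c (a j)"
      using x y pt_coset by simp
    then have "i = j"
      using orbit_eqI x y by blast
    then show "x = y"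
      using coset_eqI[OF a_closed[OF x(1)] x(2) y(2)] eq x(3) y(3) by simp
  qed simp
next
  fix x assume "x \<in> X"
  then obtain i b where x: "i \<in> I" "b \<in> carrier B" "x = (i, b <# St B (a i))"
    by (rule X_cases)
  then show "pt x \<in> \<Union>I"
    using lam_mem_orbit[OF x(1,2)] pt_coset by auto
next
  fix s assume "s \<in> \<Union>I"
  then obtain i b where i: "i \<in> I" "b \<in> carrier B" "s = lam B b (a i)"
    by (rule Union_cases)
  then have "s = pt (i, b <# St B (a i))"
    by (simp add: pt_coset)
  then show "\<exists>x \<in> X. s = pt x"
    using i coset_mem_X by blast
qed

lemma Union_carrier: "s \<in> \<Union>I \<Longrightarrow> s \<in> carrier B"
  using orbit_carrier by blast

lemma pt_mem: "x \<in> X \<Longrightarrow> pt x \<in> \<Union>I"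
  using pt_bij by (rule bij_betwE[THEN bspec])

lemma pt_closed: "x \<in> X \<Longrightarrow> pt x \<in> carrier B"
  using pt_mem Union_carrier by blast

lemma brace_f_pt:
  assumes "x \<in> X" "y \<in> X"
  shows "brace_f B a x y \<in> X" "pt (brace_f B a x y) = lam B (pt x) (pt y)"
proof -
  obtain i b j c where x: "i \<in> I" "b \<in> carrier B" "x = (i, b <# St B (a i))"
    and y: "j \<in> I" "c \<in> carrier B" "y = (j, c <# St B (a j))"
    using assms by (meson X_cases)
  have "brace_f B a x y = (j, (lam B b (a i) \<otimes> c) <# St B (a j))"
    using x y brace_f_coset a_closed by simp
  then show "brace_f B a x y \<in> X" "pt (brace_f B a x y) = lam B (pt x) (pt y)"
    using x y by (simp_all add: coset_mem_X pt_coset a_closed lam_closed lam_mult)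
qed

lemma orbits_ndi_solution: "ndi_solution (\<Union>I) orbit_r"
proof (rule orbit_r_ndi_solution)
  show "\<Union>I \<noteq> {}"
    using I(1) a_mem by blast
qed (use Union_carrier lam_Union in blast)+

text \<open>
  Under \<open>pt\<close> the map \<open>f\<^sub>x\<close> on cosets becomes \<open>\<lambda>\<close> of the point of \<open>x\<close>, so the whole solution becomes the
  braiding on the union of the orbits.
\<close>

lemma brace_r_pt:
  assumes "x \<in> X" "y \<in> X"
  shows "brace_r B I a (x, y) \<in> X \<times> X \<and> map_prod pt pt (brace_r B I a (x, y)) = orbit_r (pt x, pt y)"
proof -
  interpret S: ndi_sol "\<Union>I" orbit_r
    by standard (rule orbits_ndi_solution)
  define u where "u = brace_f B a x y"
  have u: "u \<in> X" "pt u = lam B (pt x) (pt y)"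
    unfolding u_def using brace_f_pt assms by simp_all
  have f: "sol_f orbit_r s t = lam B s t" for s t
    by (simp add: sol_f_def orbit_r_def)
  have "bij_betw (brace_f B a u) X X"
    by (rule bij_betw_conjugate[OF pt_bij S.f_bij[of "pt u"]])
      (use u pt_mem[OF u(1)] brace_f_pt in \<open>simp_all add: f del: Union_iff\<close>)
  define w where "w = inv_into X (brace_f B a u) x"
  have w: "w \<in> X" "brace_f B a u w = x"
    unfolding w_def using \<open>bij_betw (brace_f B a u) X X\<close> assms
    by (auto simp: bij_betw_def f_inv_into_f inv_into_into)
  then have "pt x = lam B (pt u) (pt w)"
    using brace_f_pt u by metis
  then have "pt w = lam B (inv (pt u)) (pt x)"
    using lam_inv_cancel(1)[of "pt u" "pt w"] u(1) w(1) pt_closed by simp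
  then show ?thesis
    using u w by (simp add: brace_r_def orbit_r_def flip: u_def w_def)
qed

lemma brace_ndi_solution: "ndi_solution X (brace_r B I a)"
  by (rule ndi_solution_transport[OF orbits_ndi_solution pt_bij brace_r_pt])

text \<open>
  This is why the condition on cores expresses faithfulness: the intersection consists of the elements
  whose \<open>\<lambda>\<close> is trivial on the points of the solution.
\<close>

lemma Inter_core:
  "(\<Inter>i \<in> I. core B (St B (a i))) = {b \<in> carrier B. \<forall>s \<in> \<Union>I. lam B b s = s}"
proof -
  have "core B (St B (a i)) = {b \<in> carrier B. \<forall>s \<in> i. lam B b s = s}" if "i \<in> I" for i
  proof -
    have "core B (St B (a i)) = (\<Inter>g \<in> carrier B. St B (lam B g (a i)))"
      using that by (simp add: core_def St_lam a_closed)
    also have "\<dots> = (\<Inter>s \<in> (\<lambda>g. lam B g (a i)) ` carrier B. St B s)"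
      by simp
    also have "\<dots> = (\<Inter>s \<in> i. St B s)"
      by (simp only: orbit_eq[OF that])
    finally show ?thesis
      using a_mem[OF that] by (auto simp: stabilizer_def)
  qed
  then show ?thesis
    using I(1) by auto
qed

text \<open>
  If \<open>f\<^sub>x = f\<^sub>y\<close>, the \<open>\<lambda>\<close>-maps of the points of \<open>x\<close> and \<open>y\<close> agree on all points; their quotient then lies in
  all cores, so the two points coincide, and \<open>pt\<close> is injective.
\<close>

lemma brace_irretractable:
  assumes core: "(\<Inter>i \<in> I. core B (St B (a i))) = {\<one>}"
  shows "irretractable X (brace_r B I a)"
  unfolding irretractable_def
proof (intro allI impI)
  fix x y assume "(x, y) \<in> ret_rel X (brace_r B I a)"
  then have x: "x \<in> X" and y: "y \<in> X" and eq: "\<And>z. z \<in> X \<Longrightarrow> brace_f B a x z = brace_f B a y z"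
    by (simp_all add: ret_rel_def sol_f_def brace_r_def)
  have "lam B (inv (pt x) \<otimes> pt y) s = s" if s: "s \<in> \<Union>I" for s
  proof -
    obtain z where z: "z \<in> X" "s = pt z"
      using pt_bij s unfolding bij_betw_def by blast
    then have "lam B (pt x) s = lam B (pt y) s"
      using eq brace_f_pt x y by metis
    then show ?thesis
      using x y s pt_closed Union_carrier lam_inv_cancel(1)[of "pt x" s] by (simp add: lam_mult)
  qed
  then have "inv (pt x) \<otimes> pt y \<in> (\<Inter>i \<in> I. core B (St B (a i)))"
    unfolding Inter_core using x y pt_closed by blast
  then have "inv (pt x) \<otimes> pt y = \<one>"
    using core by simp
  then have "pt x = pt y"
    using x y pt_closed by (metis inv_closed inv_equality inv_inv)
  then show "x = y"
    using pt_bij x y by (auto simp: bij_betw_def dest: inj_onD)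
qed

end

lemma brace_data_solution:
  assumes "brace_data B I a"
  shows "ndi_solution (brace_X B I a) (brace_r B I a)" "irretractable (brace_X B I a) (brace_r B I a)"
proof -
  note data = assms[unfolded brace_data_def]
  interpret left_brace B
    by (rule data[THEN conjunct1])
  interpret brace_orbits B I a
  proof
    show "I \<noteq> {}" "I \<subseteq> lam_orbits B" "\<And>i. i \<in> I \<Longrightarrow> a i \<in> i"
      using data by blast+
  qed
  show "ndi_solution X (brace_r B I a)"
    by (rule brace_ndi_solution)
  have "(\<Inter>i \<in> I. core B (St B (a i))) = {\<one>\<^bsub>B\<^esub>}"
    using data by blast
  then show "irretractable X (brace_r B I a)"
    by (rule brace_irretractable)
qed


section \<open>The permutation brace of a solution\<close>

text \<open>
  The notation \<open>inv\<close> stands for the inverse in a group structure; the inverse of a permutation, as a map,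
  has its own name.
\<close>

abbreviation pinv :: "('x \<Rightarrow> 'x) \<Rightarrow> 'x \<Rightarrow> 'x" where
  "pinv \<equiv> inv_into UNIV"

context ndi_sol
begin

text \<open>
  The map \<open>f\<^sub>x\<close> extended by the identity outside \<open>X\<close>, so that the permutations of \<open>X\<close> become functions on the
  whole type that compose with \<open>\<circ>\<close>.
\<close>

definition perm :: "'x \<Rightarrow> 'x \<Rightarrow> 'x" where
  "perm x y = (if y \<in> X then f x y else y)"

lemma perm_permutes: "x \<in> X \<Longrightarrow> perm x permutes X"
  by (rule bij_imp_permutes) (auto simp: perm_def f_bij cong: bij_betw_cong)

lemma perm_eq: "y \<in> X \<Longrightarrow> perm x y = f x y"
  by (simp add: perm_def)

text \<open>
  The equation \<open>f\<^sub>x \<circ> f\<^sub>u = f\<^sub>y \<circ> f\<^sub>v\<close> for \<open>r(x, u) = (y, v)\<close>, written in a form that is symmetric in \<open>x\<close> and \<open>y\<close>.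
  It is what makes the steps below commute.
\<close>

lemma perm_swap:
  assumes x: "x \<in> X" and y: "y \<in> X"
  shows "perm x \<circ> perm (pinv (perm x) y) = perm y \<circ> perm (pinv (perm y) x)"
proof -
  define u where "u = pinv (perm x) y"
  have u: "u \<in> X" "perm x u = y"
    unfolding u_def using perm_permutes[OF x] y
    by (simp_all add: permutes_inv permutes_in_image permutes_inverses)
  then have fu: "f x u = y"
    by (simp add: perm_eq)
  have "perm y (g u x) = x"
    using involution(1)[OF x u(1)] fu x u by (simp add: perm_eq g_closed)
  then have v: "pinv (perm y) x = g u x"
    using perm_permutes[OF y] by (simp add: permutes_inv_eq)
  have "perm x (perm u z) = perm y (perm (g u x) z)" for z
    using f_f[OF x u(1), of z] fu x y u by (simp add: perm_def f_closed g_closed)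
  then show ?thesis
    using v u_def by auto
qed

text \<open>
  The point \<open>u\<close> with \<open>r(x, u) = (x, u)\<close>. Bijectivity of this map is needed to undo a step; here the
  bijectivity of the maps \<open>g\<close> enters, as \<open>diag\<close> has the inverse \<open>y \<mapsto> (g\<^sub>y)\<^sup>-\<^sup>1(y)\<close>.
\<close>

definition diag :: "'x \<Rightarrow> 'x" where
  "diag x = pinv (perm x) x"

lemma diag_bij: "bij_betw diag X X"
proof (rule bij_betwI')
  have diag: "diag x \<in> X" "f x (diag x) = x" if "x \<in> X" for x
  proof -
    show "diag x \<in> X"
      unfolding diag_def using perm_permutes that by (simp add: permutes_inv permutes_in_image)
    then show "f x (diag x) = x"
      using perm_permutes[OF that] by (simp add: diag_def permutes_inverses flip: perm_eq)
  qed
  have g_diag: "g (diag x) x = diag x" if "x \<in> X" for x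
    using that diag[OF that] involution(1)[of x "diag x"] f_cancel[of x "g (diag x) x" "diag x"]
    by (simp add: g_closed)
  show "diag x \<in> X" if "x \<in> X" for x
    using diag that by blast
  show "diag x = diag y \<longleftrightarrow> x = y" if x: "x \<in> X" and y: "y \<in> X" for x y
  proof
    assume eq: "diag x = diag y"
    have "g (diag x) x = g (diag x) y"
      using g_diag[OF x] g_diag[OF y] eq by simp
    then show "x = y"
      by (rule g_cancel) (use x y diag in auto)
  qed simp
  show "\<exists>x\<in>X. y = diag x" if y: "y \<in> X" for y
  proof -
    \<comment> \<open>The preimage is \<open>(g\<^sub>y)\<^sup>-\<^sup>1(y)\<close>.\<close>
    obtain u where u: "u \<in> X" "g y u = y"
      using g_bij[OF y] y by (metis bij_betw_imp_surj_on imageE)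
    have "g y (f u y) = y"
      using involution(2)[OF u(1) y] u(2) by simp
    then have "f u y = u"
      using g_cancel[of y "f u y" u] u y by (simp add: f_closed)
    then have "perm u y = u"
      using y by (simp add: perm_eq)
    then have "y = diag u"
      using perm_permutes[OF u(1)] by (simp add: diag_def permutes_inverses(2) flip: permutes_inv_eq)
    then show ?thesis
      using u by blast
  qed
qed

section \<open>The abelian group of translations\<close>

text \<open>
  The step in direction \<open>x\<close> will be the addition of \<open>f\<^sub>x\<close> in the brace. Its form is forced: in a
  brace with \<open>\<lambda>\<^sub>p(f\<^sub>y) = f\<^bsub>p(y)\<^esub>\<close> one has \<open>p + f\<^sub>x = p + \<lambda>\<^sub>p(f\<^sub>y) = p f\<^sub>y\<close> for \<open>y = p\<^sup>-\<^sup>1(x)\<close>.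
\<close>

definition step :: "'x \<Rightarrow> ('x \<Rightarrow> 'x) \<Rightarrow> 'x \<Rightarrow> 'x" where
  "step x p = p \<circ> perm (pinv p x)"

text \<open>
  The inverse of a step: if \<open>step x w = p\<close> with \<open>w\<^sup>-\<^sup>1(x) = t\<close>, then \<open>p\<^sup>-\<^sup>1(x) = diag t\<close>, which determines \<open>t\<close> and
  hence \<open>w\<close>.
\<close>

definition unstep :: "'x \<Rightarrow> ('x \<Rightarrow> 'x) \<Rightarrow> 'x \<Rightarrow> 'x" where
  "unstep x p = p \<circ> pinv (perm (inv_into X diag (pinv p x)))"

lemma inv_closed: "p permutes X \<Longrightarrow> x \<in> X \<Longrightarrow> pinv p x \<in> X"
  by (simp add: permutes_inv permutes_in_image)

lemma diag_inv:
  assumes "x \<in> X"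
  shows "inv_into X diag x \<in> X" "diag (inv_into X diag x) = x"
  using diag_bij assms by (auto simp: bij_betw_def f_inv_into_f inv_into_into)

lemma step_permutes: "p permutes X \<Longrightarrow> x \<in> X \<Longrightarrow> step x p permutes X"
  unfolding step_def by (intro permutes_compose perm_permutes inv_closed)

lemma unstep_permutes: "p permutes X \<Longrightarrow> x \<in> X \<Longrightarrow> unstep x p permutes X"
  unfolding unstep_def by (intro permutes_compose perm_permutes permutes_inv diag_inv inv_closed)

lemma step_unstep:
  assumes p: "p permutes X" and x: "x \<in> X"
  shows "step x (unstep x p) = p"
proof -
  define t where "t = inv_into X diag (pinv p x)"
  have t: "t \<in> X" "diag t = pinv p x"
    unfolding t_def using diag_inv inv_closed p x by auto
  note pt = perm_permutes[OF t(1)]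
  have "perm t (pinv p x) = t"
    using t pt by (simp add: diag_def permutes_inverses flip: t(2))
  then have "pinv (p \<circ> pinv (perm t)) x = t"
    using p pt permutes_inv[OF pt] by (simp add: o_inv_distrib permutes_bij permutes_inv_inv)
  then show ?thesis
    using pt by (simp add: step_def unstep_def permutes_inv_o o_assoc[symmetric] flip: t_def)
qed

lemma unstep_step:
  assumes p: "p permutes X" and x: "x \<in> X"
  shows "unstep x (step x p) = p"
proof -
  define y where "y = pinv p x"
  have y: "y \<in> X"
    unfolding y_def using inv_closed p x .
  note py = perm_permutes[OF y]
  have "pinv (step x p) x = diag y"
    using p py by (simp add: step_def diag_def o_inv_distrib permutes_bij flip: y_def)
  moreover have "inv_into X diag (diag y) = y"
    using diag_bij y by (simp add: bij_betw_def inv_into_f_f)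
  ultimately show ?thesis
    using py by (simp add: unstep_def) (simp add: step_def permutes_inv_o o_assoc[symmetric] flip: y_def)
qed

lemma step_commute:
  assumes p: "p permutes X" and x: "x \<in> X" and y: "y \<in> X"
  shows "step x (step y p) = step y (step x p)"
proof -
  have *: "step x (step y p) = p \<circ> (perm (pinv p y) \<circ> perm (pinv (perm (pinv p y)) (pinv p x)))"
    if "x \<in> X" "y \<in> X" for x y
    using p perm_permutes[OF inv_closed[OF p that(2)]]
    by (simp add: step_def o_inv_distrib permutes_bij o_assoc)
  show ?thesis
    using *[OF x y] *[OF y x] perm_swap inv_closed[OF p] x y by simp
qed

text \<open>
  Left multiplication by \<open>q\<close> permutes the steps as \<open>q\<close> permutes the points. This is the source of the
  brace identity.
\<close>

lemma step_equivariant: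
  assumes p: "p permutes X" and q: "q permutes X"
  shows "step (q x) (q \<circ> p) = q \<circ> step x p"
  using p q by (simp add: step_def o_inv_distrib permutes_bij permutes_inverses o_assoc)

lemma unstep_equivariant:
  assumes p: "p permutes X" and q: "q permutes X"
  shows "unstep (q x) (q \<circ> p) = q \<circ> unstep x p"
  using p q by (simp add: unstep_def o_inv_distrib permutes_bij permutes_inverses o_assoc)

text \<open>
  The group generated by the steps. Its members are maps on all functions; only their values on
  permutations of \<open>X\<close> matter, where the group is abelian.
\<close>

inductive_set translation_group :: "(('x \<Rightarrow> 'x) \<Rightarrow> 'x \<Rightarrow> 'x) set" where
  id: "id \<in> translation_group"
| step: "\<lbrakk>t \<in> translation_group; x \<in> X\<rbrakk> \<Longrightarrow> step x \<circ> t \<in> translation_group"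
| unstep: "\<lbrakk>t \<in> translation_group; x \<in> X\<rbrakk> \<Longrightarrow> unstep x \<circ> t \<in> translation_group"

lemma translation_permutes: "t \<in> translation_group \<Longrightarrow> p permutes X \<Longrightarrow> t p permutes X"
  by (induction rule: translation_group.induct) (simp_all add: step_permutes unstep_permutes)

lemma translation_comp: "t \<in> translation_group \<Longrightarrow> u \<in> translation_group \<Longrightarrow> t \<circ> u \<in> translation_group"
  by (induction rule: translation_group.induct) (simp_all add: translation_group.intros o_assoc[symmetric])

text \<open>
  A map that commutes with an invertible map commutes with its inverse.
\<close>

lemma unstep_commute:
  assumes u: "\<And>p. p permutes X \<Longrightarrow> u p permutes X"
    and comm: "\<And>p. p permutes X \<Longrightarrow> u (step x p) = step x (u p)"
    and p: "p permutes X" and x: "x \<in> X"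
  shows "u (unstep x p) = unstep x (u p)"
proof -
  have "u (unstep x p) = unstep x (step x (u (unstep x p)))"
    using u unstep_permutes p x by (simp add: unstep_step)
  also have "\<dots> = unstep x (u p)"
    using comm[of "unstep x p"] unstep_permutes p x by (simp add: step_unstep)
  finally show ?thesis .
qed

lemma step_translation:
  assumes "t \<in> translation_group" "p permutes X" "x \<in> X"
  shows "step x (t p) = t (step x p)"
  using assms
proof (induction arbitrary: p rule: translation_group.induct)
  case (step t y)
  then show ?case
    using step_commute[of "t p" x y] translation_permutes by simp
next
  case (unstep t y)
  have "step x (unstep y (t p)) = unstep y (step x (t p))"
    by (rule unstep_commute)
      (use unstep translation_permutes step_permutes step_commute in auto)
  then show ?case
    using unstep by simp
qed simp

lemma translation_commute:
  assumes "t \<in> translation_group" "u \<in> translation_group" "p permutes X"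
  shows "t (u p) = u (t p)"
  using assms
proof (induction arbitrary: p rule: translation_group.induct)
  case (step t x)
  then show ?case
    using step_translation[of u "t p" x] translation_permutes by simp
next
  case (unstep t x)
  have "u (unstep x (t p)) = unstep x (u (t p))"
    by (rule unstep_commute)
      (use unstep translation_permutes step_translation in auto)
  then show ?case
    using unstep by simp
qed simp

lemma translation_inverse:
  assumes "t \<in> translation_group"
  obtains u where "u \<in> translation_group"
    "\<And>p. p permutes X \<Longrightarrow> u (t p) = p" "\<And>p. p permutes X \<Longrightarrow> t (u p) = p"
proof -
  have "\<exists>u \<in> translation_group. \<forall>p. p permutes X \<longrightarrow> u (t p) = p"
    using assms
  proof (induction rule: translation_group.induct)
    case id
    then show ?case
      by (intro bexI[OF _ translation_group.id]) simp
  next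
    case (step t x)
    then obtain u where u: "u \<in> translation_group" "\<And>p. p permutes X \<Longrightarrow> u (t p) = p"
      by blast
    have "(u \<circ> (unstep x \<circ> id)) ((step x \<circ> t) p) = p" if "p permutes X" for p
      using that u step by (simp add: unstep_step translation_permutes)
    moreover have "u \<circ> (unstep x \<circ> id) \<in> translation_group"
      using u step by (intro translation_comp translation_group.intros)
    ultimately show ?case
      by blast
  next
    case (unstep t x)
    then obtain u where u: "u \<in> translation_group" "\<And>p. p permutes X \<Longrightarrow> u (t p) = p"
      by blast
    have "(u \<circ> (step x \<circ> id)) ((unstep x \<circ> t) p) = p" if "p permutes X" for p
      using that u unstep by (simp add: step_unstep translation_permutes)
    moreover have "u \<circ> (step x \<circ> id) \<in> translation_group"
      using u unstep by (intro translation_comp translation_group.intros)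
    ultimately show ?case
      by blast
  qed
  then obtain u where u: "u \<in> translation_group" "\<And>p. p permutes X \<Longrightarrow> u (t p) = p"
    by blast
  with that[OF u] translation_commute[OF assms u(1)] show thesis
    by simp
qed

lemma translation_conjugate:
  assumes "t \<in> translation_group" "q permutes X"
  obtains u where "u \<in> translation_group" "\<And>p. p permutes X \<Longrightarrow> u (q \<circ> p) = q \<circ> t p"
proof -
  have "\<exists>u \<in> translation_group. \<forall>p. p permutes X \<longrightarrow> u (q \<circ> p) = q \<circ> t p"
    using assms
  proof (induction rule: translation_group.induct)
    case id
    then show ?case
      by (intro bexI[OF _ translation_group.id]) simp
  next
    case (step t x)
    then obtain u where u: "u \<in> translation_group" "\<And>p. p permutes X \<Longrightarrow> u (q \<circ> p) = q \<circ> t p"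
      by blast
    have "(step (q x) \<circ> u) (q \<circ> p) = q \<circ> (step x \<circ> t) p" if "p permutes X" for p
      using that u step by (simp add: step_equivariant translation_permutes)
    moreover have "step (q x) \<circ> u \<in> translation_group"
      using u step by (intro translation_group.intros) (simp_all add: permutes_in_image)
    ultimately show ?case
      by blast
  next
    case (unstep t x)
    then obtain u where u: "u \<in> translation_group" "\<And>p. p permutes X \<Longrightarrow> u (q \<circ> p) = q \<circ> t p"
      by blast
    have "(unstep (q x) \<circ> u) (q \<circ> p) = q \<circ> (unstep x \<circ> t) p" if "p permutes X" for p
      using that u unstep by (simp add: unstep_equivariant translation_permutes)
    moreover have "unstep (q x) \<circ> u \<in> translation_group"
      using u unstep by (intro translation_group.intros) (simp_all add: permutes_in_image)
    ultimately show ?case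
      by blast
  qed
  with that show thesis
    by blast
qed

section \<open>The brace structure\<close>

text \<open>
  The orbit of the identity under the translations; it is the group generated by the maps \<open>f\<^sub>x\<close>.
\<close>

definition perm_group :: "('x \<Rightarrow> 'x) set" where
  "perm_group = (\<lambda>t. t id) ` translation_group"

text \<open>
  The abelian group of translations is transitive on \<open>perm_group\<close> by definition, hence a translation is
  determined on \<open>perm_group\<close> by its value at \<open>id\<close>. This identifies the translations of \<open>perm_group\<close> with its
  elements and transports their composition to an addition: \<open>t(id) + u(id) = t(u(id))\<close>.
\<close>

definition padd :: "('x \<Rightarrow> 'x) \<Rightarrow> ('x \<Rightarrow> 'x) \<Rightarrow> 'x \<Rightarrow> 'x" where
  "padd p q = (SOME t. t \<in> translation_group \<and> t id = p) q"

definition perm_brace :: "('x \<Rightarrow> 'x) ring" where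
  "perm_brace = \<lparr>carrier = perm_group, monoid.mult = (\<circ>), one = id, zero = id, add = padd\<rparr>"

lemma perm_brace_simps [simp]:
  "carrier perm_brace = perm_group" "monoid.mult perm_brace = (\<circ>)" "one perm_brace = id"
  "zero perm_brace = id" "add perm_brace = padd"
  by (simp_all add: perm_brace_def)

lemma id_permutes: "id permutes X"
  by (rule permutes_id)

lemma perm_group_cases:
  assumes "p \<in> perm_group"
  obtains t where "t \<in> translation_group" "p = t id"
  using assms by (auto simp: perm_group_def)

lemma translation_id_mem: "t \<in> translation_group \<Longrightarrow> t id \<in> perm_group"
  by (simp add: perm_group_def)

lemma perm_group_permutes: "p \<in> perm_group \<Longrightarrow> p permutes X"
  by (metis perm_group_cases translation_permutes id_permutes)

text \<open>
  The choice in \<open>padd\<close> is immaterial: if \<open>u(id) = t(id)\<close> and \<open>q = w(id)\<close>, then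
  \<open>u(q) = w(u(id)) = w(t(id)) = t(q)\<close>.
\<close>

lemma padd_translation:
  assumes t: "t \<in> translation_group" and q: "q \<in> perm_group"
  shows "padd (t id) q = t q"
proof -
  define u where "u = (SOME u. u \<in> translation_group \<and> u id = t id)"
  have u: "u \<in> translation_group" "u id = t id"
    unfolding u_def using someI[of "\<lambda>u. u \<in> translation_group \<and> u id = t id" t] t by simp_all
  obtain w where w: "w \<in> translation_group" "q = w id"
    using q by (rule perm_group_cases)
  have "u q = t q"
    using translation_commute[OF u(1) w(1) id_permutes] translation_commute[OF t w(1) id_permutes]
      u(2) w(2) by simp
  then show ?thesis
    by (simp add: padd_def u_def)
qed

lemma translation_mem:
  assumes "t \<in> translation_group" "p \<in> perm_group"
  shows "t p \<in> perm_group"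
proof -
  obtain u where u: "u \<in> translation_group" "p = u id"
    using assms(2) by (rule perm_group_cases)
  then show ?thesis
    using translation_id_mem[OF translation_comp[OF assms(1) u(1)]] by simp
qed

lemma comp_translation:
  assumes "p \<in> perm_group" "t \<in> translation_group"
  obtains u where "u \<in> translation_group" "\<And>q. q \<in> perm_group \<Longrightarrow> p \<circ> t q = u (p \<circ> q)"
  using translation_conjugate[OF assms(2) perm_group_permutes[OF assms(1)]] perm_group_permutes
  by metis

text \<open>
  For \<open>q = t(id)\<close>, conjugating \<open>t\<close> by left multiplication with \<open>p\<close> gives a translation \<open>u\<close> with \<open>p q = u(p)\<close>;
  so \<open>p q\<close> stays in the orbit of \<open>id\<close>.
\<close>

lemma comp_mem:
  assumes "p \<in> perm_group" "q \<in> perm_group"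
  shows "p \<circ> q \<in> perm_group"
proof -
  obtain t where t: "t \<in> translation_group" "q = t id"
    using assms(2) by (rule perm_group_cases)
  obtain u where u: "u \<in> translation_group" "\<And>q. q \<in> perm_group \<Longrightarrow> p \<circ> t q = u (p \<circ> q)"
    using comp_translation[OF assms(1) t(1)] by blast
  have "p \<circ> q = u p"
    using u(2)[of id] t translation_id_mem[OF translation_group.id] by simp
  then show ?thesis
    using translation_mem u(1) assms(1) by simp
qed

lemma inv_mem:
  assumes "p \<in> perm_group"
  shows "pinv p \<in> perm_group"
proof -
  have p: "p permutes X"
    using assms by (rule perm_group_permutes)
  obtain t where t: "t \<in> translation_group" "p = t id"
    using assms by (rule perm_group_cases)
  obtain u where u: "u \<in> translation_group" "u p = id"
    using translation_inverse[OF t(1)] t(2) id_permutes by metis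
  obtain w where "w \<in> translation_group" "w (pinv p \<circ> p) = pinv p \<circ> u p"
    using translation_conjugate[OF u(1) permutes_inv[OF p]] p by metis
  then have "w \<in> translation_group" "w id = pinv p"
    using u(2) p by (simp_all add: permutes_inv_o)
  then show ?thesis
    using translation_id_mem by metis
qed

text \<open>
  Let \<open>q = u(id)\<close>, and let \<open>u'\<close> be the translation conjugate to \<open>u\<close> under left multiplication by \<open>p\<close>. Then
  \<open>p (q + w) = u'(p w)\<close>, while \<open>p q = u'(p)\<close> is the value at \<open>id\<close> of \<open>u'\<close> composed with the translation of \<open>p\<close>.
  Hence both sides of the brace identity are \<open>u'(p w) + p\<close>.
\<close>

lemma perm_brace_left_brace: "left_brace perm_brace"
proof -
  have id: "id \<in> perm_group"
    using translation_id_mem[OF translation_group.id] by simp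
  have add: "abelian_group perm_brace"
  proof (rule abelian_groupI; simp)
    fix p q assume p: "p \<in> perm_group" and q: "q \<in> perm_group"
    obtain t where t: "t \<in> translation_group" "p = t id"
      using p by (rule perm_group_cases)
    obtain u where u: "u \<in> translation_group" "q = u id"
      using q by (rule perm_group_cases)
    show "padd p q \<in> perm_group"
      using t q by (simp add: padd_translation translation_mem)
    have "padd p q = t (u id)" "padd q p = u (t id)"
      using t u p q by (simp_all add: padd_translation)
    then show "padd p q = padd q p"
      using translation_commute[OF t(1) u(1) id_permutes] by simp
    fix w assume w: "w \<in> perm_group"
    have "padd (padd p q) w = padd ((t \<circ> u) id) w"
      using t u p q by (simp add: padd_translation)
    also have "\<dots> = t (u w)"
      by (subst padd_translation) (use t u w translation_comp in auto)
    also have "\<dots> = padd p (padd q w)"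
      using t u w by (simp add: padd_translation translation_mem)
    finally show "padd (padd p q) w = padd p (padd q w)" .
  next
    show "id \<in> perm_group" by (rule id)
  next
    fix p assume p: "p \<in> perm_group"
    show "padd id p = p"
      using padd_translation[OF translation_group.id p] by simp
    obtain t where t: "t \<in> translation_group" "p = t id"
      using p by (rule perm_group_cases)
    obtain u where u: "u \<in> translation_group" "u p = id"
      using translation_inverse[OF t(1)] t(2) id_permutes by metis
    show "\<exists>q\<in>perm_group. padd q p = id"
      using padd_translation[OF u(1) p] u translation_id_mem by auto
  qed
  have mult: "group perm_brace"
  proof (rule groupI; simp)
    fix p q assume "p \<in> perm_group" "q \<in> perm_group"
    then show "p \<circ> q \<in> perm_group"
      by (rule comp_mem)
  next
    show "id \<in> perm_group" by (rule id)
  next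
    fix p assume "p \<in> perm_group"
    then show "\<exists>q\<in>perm_group. q \<circ> p = id"
      using inv_mem perm_group_permutes permutes_inv_o by blast
  qed (simp add: o_assoc)
  show ?thesis
  proof (intro left_brace.intro add mult left_brace_axioms.intro; simp)
    fix p q w assume p: "p \<in> perm_group" and q: "q \<in> perm_group" and w: "w \<in> perm_group"
    obtain t where t: "t \<in> translation_group" "p = t id"
      using p by (rule perm_group_cases)
    obtain u where u: "u \<in> translation_group" "q = u id"
      using q by (rule perm_group_cases)
    obtain u' where u': "u' \<in> translation_group" "\<And>q. q \<in> perm_group \<Longrightarrow> p \<circ> u q = u' (p \<circ> q)"
      using comp_translation[OF p u(1)] by blast
    have pq: "p \<circ> q = (u' \<circ> t) id"
      using u'(2)[OF id] u(2) t(2) by simp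
    have "padd (p \<circ> padd q w) p = padd p (p \<circ> padd q w)"
      by (rule abelian_monoid.a_comm[OF abelian_group.axioms(1)[OF add], simplified])
        (use p q w u comp_mem in \<open>simp_all add: padd_translation translation_mem\<close>)
    also have "\<dots> = padd p (u' (p \<circ> w))"
      using u u' w by (simp add: padd_translation)
    also have "\<dots> = t (u' (p \<circ> w))"
      using t u' p w comp_mem by (simp add: padd_translation translation_mem)
    also have "\<dots> = u' (t (p \<circ> w))"
      using translation_commute[OF t(1) u'(1)] perm_group_permutes comp_mem p w by simp
    also have "\<dots> = padd (p \<circ> q) (p \<circ> w)"
      unfolding pq by (subst padd_translation) (use t u' p w comp_mem translation_comp in auto)
    finally show "padd (p \<circ> padd q w) p = padd (p \<circ> q) (p \<circ> w)" .
  qed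
qed

sublocale PB: left_brace perm_brace
  by (rule perm_brace_left_brace)

lemma perm_mem: "x \<in> X \<Longrightarrow> perm x \<in> perm_group"
  using translation_id_mem[OF translation_group.step[OF translation_group.id]] by (simp add: step_def)

lemma padd_perm:
  assumes "x \<in> X" "p \<in> perm_group"
  shows "padd (perm x) p = step x p"
  using padd_translation[OF translation_group.step[OF translation_group.id assms(1)] assms(2)]
  by (simp add: step_def)

text \<open>
  So \<open>\<lambda>\<close> acts on the permutations \<open>f\<^sub>x\<close> as the group acts on the points. By injectivity of \<open>x \<mapsto> f\<^sub>x\<close> in the
  irretractable case, \<open>X\<close> with its solution sits inside the brace as a union of \<open>\<lambda>\<close>-orbits.
\<close>

lemma lam_perm:
  assumes p: "p \<in> perm_group" and x: "x \<in> X"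
  shows "lam perm_brace p (perm x) = perm (p x)"
proof -
  have px: "p x \<in> X"
    using perm_group_permutes[OF p] x by (simp add: permutes_in_image)
  have "p \<circ> perm x = padd (perm (p x)) p"
    using perm_group_permutes[OF p] px p by (simp add: padd_perm step_def permutes_inverses)
  also have "\<dots> = padd p (perm (p x))"
    using PB.a_comm[of "perm (p x)" p] perm_mem px p by simp
  finally show ?thesis
    using PB.r_neg1[of p "perm (p x)"] perm_mem px p by (simp add: lam_def)
qed

lemma perm_generates: "generate (add_monoid perm_brace) (perm ` X) = perm_group"
proof
  show "generate (add_monoid perm_brace) (perm ` X) \<subseteq> perm_group"
    using group.generate_incl[OF PB.a_group, of "perm ` X"] perm_mem by auto
  have plus: "monoid.mult (add_monoid perm_brace) = padd"
    by simp
  have "t id \<in> generate (add_monoid perm_brace) (perm ` X)" if "t \<in> translation_group" for t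
    using that
  proof (induction rule: translation_group.induct)
    case id
    have "id id = one (add_monoid perm_brace)"
      by simp
    then show ?case
      by (metis generate.one)
  next
    case (step t x)
    have "padd (perm x) (t id) \<in> generate (add_monoid perm_brace) (perm ` X)"
      unfolding plus[symmetric]
      by (intro generate.eng generate.incl imageI step.hyps step.IH)
    then show ?case
      unfolding o_apply using padd_perm[OF step.hyps(2) translation_id_mem[OF step.hyps(1)]] by metis
  next
    case (unstep t x)
    let ?m = "inv\<^bsub>add_monoid perm_brace\<^esub> (perm x)" and ?p = "t id"
    have p: "?p \<in> perm_group"
      using unstep translation_id_mem by simp
    have q: "unstep x ?p \<in> perm_group"
      using translation_id_mem[OF translation_group.unstep[OF unstep.hyps]] by simp
    have "padd (perm x) (unstep x ?p) = ?p"
      using padd_perm q unstep perm_group_permutes[OF p] by (simp add: step_unstep)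
    then have "unstep x ?p = padd ?m ?p"
      using PB.r_neg1[of "perm x" "unstep x ?p"] perm_mem q unstep.hyps by (simp add: a_inv_def)
    moreover have "padd ?m ?p \<in> generate (add_monoid perm_brace) (perm ` X)"
      unfolding plus[symmetric]
      by (intro generate.eng generate.inv imageI unstep.hyps unstep.IH)
    ultimately show ?case
      unfolding o_apply by metis
  qed
  then show "perm_group \<subseteq> generate (add_monoid perm_brace) (perm ` X)"
    by (auto simp: perm_group_def)
qed

lemma perm_inj:
  assumes "irretractable X r"
  shows "inj_on perm X"
proof (rule inj_onI)
  fix x y assume "x \<in> X" "y \<in> X" "perm x = perm y"
  then have "(x, y) \<in> ret_rel X r"
    unfolding ret_rel_def by (auto simp flip: perm_eq)
  then show "x = y"
    using assms by (simp add: irretractable_def)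
qed

text \<open>
  Since \<open>\<lambda>\<^sub>p(f\<^sub>x) = f\<^bsub>p(x)\<^esub>\<close> and \<open>x \<mapsto> f\<^sub>x\<close> is injective, such a \<open>p\<close> fixes every point. Both the triviality of the
  socle and that of the intersection of the cores are instances.
\<close>

lemma lam_fixes_perm:
  assumes irr: "irretractable X r" and p: "p \<in> perm_group"
    and fixed: "\<And>x. x \<in> X \<Longrightarrow> lam perm_brace p (perm x) = perm x"
  shows "p = id"
proof
  fix x
  note pp = perm_group_permutes[OF p]
  show "p x = id x"
  proof (cases "x \<in> X")
    case True
    then have "perm (p x) = perm x"
      using fixed lam_perm p by simp
    then show ?thesis
      using True perm_inj[OF irr] pp by (auto simp: permutes_in_image dest: inj_onD)
  next
    case False
    then show ?thesis
      using pp by (simp add: permutes_not_in)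
  qed
qed

text \<open>
  The orbits are those of the elements \<open>f\<^sub>x\<close>, and the base points are arbitrary. Both the solution on cosets
  (through \<open>pt\<close>) and the given one (through \<open>perm\<close>) are copies of the braiding on the union of these orbits.
\<close>

lemma irretractable_from_brace:
  assumes irr: "irretractable X r"
  shows "\<exists>(B :: ('x \<Rightarrow> 'x) ring) I a. brace_data B I a \<and>
    sol_isomorphic (brace_X B I a) (brace_r B I a) X r"
proof -
  let ?B = perm_brace
  define I where "I = (\<lambda>x. orbit ?B (lam ?B) (perm x)) ` X"
  define a :: "('x \<Rightarrow> 'x) set \<Rightarrow> 'x \<Rightarrow> 'x" where "a = (\<lambda>i. SOME c. c \<in> i)"
  have a: "a i \<in> i" if i: "i \<in> lam_orbits ?B" for i
  proof -
    obtain p where "p \<in> perm_group" "i = orbit ?B (lam ?B) p"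
      using i unfolding orbits_def perm_brace_simps by blast
    then have "lam ?B id p \<in> i"
      using PB.one_closed by (auto simp: orbit_def)
    then show ?thesis
      unfolding a_def by (rule someI[of "\<lambda>c. c \<in> i"])
  qed
  have I: "I \<noteq> {}" "I \<subseteq> lam_orbits ?B"
    using ne perm_mem by (auto simp: I_def orbits_def)
  have Un: "\<Union>I = perm ` X"
  proof (intro equalityI subsetI)
    fix s assume "s \<in> \<Union>I"
    then obtain x p where xp: "x \<in> X" "p \<in> perm_group" "s = lam ?B p (perm x)"
      by (auto simp: I_def orbit_def)
    then show "s \<in> perm ` X"
      using perm_group_permutes by (auto simp: lam_perm permutes_in_image)
  next
    fix s assume "s \<in> perm ` X"
    then obtain x where x: "x \<in> X" "s = perm x"
      by blast
    then have "s = lam ?B id (perm x)"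
      using PB.lam_one perm_mem by simp
    then have "s \<in> orbit ?B (lam ?B) (perm x)"
      using PB.one_closed unfolding orbit_def by auto
    then show "s \<in> \<Union>I"
      using x by (auto simp: I_def)
  qed
  interpret O: brace_orbits ?B I a
    by standard (use I a in auto)
  have soc: "socle ?B = {id}"
    using lam_fixes_perm[OF irr] perm_mem PB.lam_one PB.one_closed by (auto simp: socle_def)
  have core: "(\<Inter>i \<in> I. core ?B (St ?B (a i))) = {id}"
    unfolding O.Inter_core Un
    using lam_fixes_perm[OF irr] perm_mem PB.lam_one PB.one_closed by auto
  have data: "brace_data ?B I a"
    unfolding brace_data_def
    using perm_brace_left_brace soc a I core perm_generates Un by simp
  define F where "F = inv_into X perm \<circ> O.pt"
  have perm_bij: "bij_betw perm X (\<Union>I)"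
    using perm_inj[OF irr] Un by (simp add: bij_betw_def)
  have F: "bij_betw F O.X X"
    unfolding F_def by (rule bij_betw_trans[OF O.pt_bij bij_betw_inv_into[OF perm_bij]])
  have perm_F: "perm (F x) = O.pt x" if "x \<in> O.X" for x
    using O.pt_mem[OF that] unfolding F_def Un by (simp add: f_inv_into_f)
  have FX: "F x \<in> X" if "x \<in> O.X" for x
    using F that by (auto dest: bij_betwE)
  have "sol_isomorphic O.X (brace_r ?B I a) X r"
  proof (rule sol_isomorphicI[OF brace_data_solution(1)[OF data] ndi F])
    fix x y assume x: "x \<in> O.X" and y: "y \<in> O.X"
    have eq: "sol_f (brace_r ?B I a) x y = brace_f ?B a x y"
      by (simp add: sol_f_def brace_r_def)
    have "perm (F (brace_f ?B a x y)) = lam ?B (perm (F x)) (perm (F y))"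
      using x y by (simp add: perm_F O.brace_f_pt)
    also have "\<dots> = perm (f (F x) (F y))"
      using x y by (simp add: lam_perm perm_mem FX perm_eq)
    finally show "F (sol_f (brace_r ?B I a) x y) = f (F x) (F y)"
      unfolding eq by (rule inj_onD[OF perm_inj[OF irr]])
        (use x y in \<open>simp_all add: FX O.brace_f_pt f_closed\<close>)
  qed
  with data show ?thesis
    by blast
qed

end

theorem theorem4p8:
  shows "(\<forall>(B :: 'b ring) I a. brace_data B I a \<longrightarrow>
            ndi_solution (brace_X B I a) (brace_r B I a) \<and>
            irretractable (brace_X B I a) (brace_r B I a)) \<and>
         (\<forall>(Y :: 'x set) r. ndi_solution Y r \<and> irretractable Y r \<longrightarrow>
            (\<exists>(B :: ('x \<Rightarrow> 'x) ring) I a. brace_data B I a \<and>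
               sol_isomorphic (brace_X B I a) (brace_r B I a) Y r))"
proof (intro conjI allI impI)
  fix B :: "'b ring" and I a assume "brace_data B I a"
  then show "ndi_solution (brace_X B I a) (brace_r B I a)" "irretractable (brace_X B I a) (brace_r B I a)"
    by (rule brace_data_solution)+
next
  fix Y :: "'x set" and r assume Y: "ndi_solution Y r \<and> irretractable Y r"
  then interpret ndi_sol Y r
    by unfold_locales simp
  show "\<exists>(B :: ('x \<Rightarrow> 'x) ring) I a. brace_data B I a \<and>
      sol_isomorphic (brace_X B I a) (brace_r B I a) Y r"
    using irretractable_from_brace Y by blast
qed

end
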